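(* Let $M\ge1$ be an integer, $N=2M+1$, let $\rho>0$ be a constant (the boundary is the circle of radius $\rho$), let $0<R<\rho$ and $R_0>0$. Let $S\in\mathbb R^{N\times(2M+1)}$, $K\in\mathbb R^{(2M+1)\times N}$ and $T_\theta\in\mathbb R^{(2M+1)\times N}$ be the matrices defined in the context. Then $$SK=T_\theta^{T}\Lambda T_\theta,$$ where $\Lambda\in\mathbb R^{(2M+1)\times(2M+1)}$ is the diagonal matrix with $$\Lambda_{1,1}=1,\qquad \Lambda_{2k,2k}=\Lambda_{2k+1,2k+1}=-\frac1k\left(\frac R\rho\right)^k\quad(k=1,\dots,M),\qquad \Lambda_{k,j}=0\quad(k\ne j).$$ Consequently, the approximate solution by the modified method of fundamental solutions is uniquely determined: for every $\boldsymbol f\in\mathbb R^N$ the linear system $SK\boldsymbol w=\boldsymbol f$ has exactly one solution $\boldsymbol w\in\mathbb R^N$.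
   Context: Put $\theta_j=2\pi(j-1)/N$ for $j=1,\dots,N$. For $j=1,\dots,N$ and $k=1,\dots,M$ define $$S_{j,1}=1,\quad S_{j,2k}=\left(\frac{R_0}{\rho}\right)^k\cos k\theta_j,\quad S_{j,2k+1}=\left(\frac{R_0}{\rho}\right)^k\sin k\theta_j;$$ $$K_{1,j}=1,\quad K_{2k,j}=-\frac1k\left(\frac R{R_0}\right)^k\cos k\theta_j,\quad K_{2k+1,j}=-\frac1k\left(\frac R{R_0}\right)^k\sin k\theta_j;$$ $$(T_\theta)_{1,j}=1,\quad (T_\theta)_{2k,j}=\cos k\theta_j,\quad (T_\theta)_{2k+1,j}=\sin k\theta_j.$$ The modified method of fundamental solutions (MMFS) for the exterior Dirichlet problem outside the disc of radius $\rho$, with source points $\zeta_j=Re^{i\theta_j}$ and boundary data $f_j$ at the points $\rho e^{i\theta_j}$, determines a coefficient vector $\boldsymbol w=(w_1,\dots,w_N)^T$ from $SK\boldsymbol w=\boldsymbol f$, $\boldsymbol f=(f_1,\dots,f_N)^T$, and then takes as approximate solution $\sum_{j=1}^N w_j\ln\bigl(|z-\zeta_j|/|z|\bigr)$. *)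

theory Defs
  imports Complex_Main "Jordan_Normal_Form.Matrix"
begin

text \<open>
  Library matrices and vectors are indexed from 0. The entry functions below take indices that
  start at 1, and \<open>mat1\<close> shifts them. An index \<open>c > 1\<close> is \<open>2 * k\<close> (cosine) or \<open>2 * k + 1\<close> (sine)
  with \<open>k = c div 2\<close>.
\<close>

definition mat1 :: "nat \<Rightarrow> nat \<Rightarrow> (nat \<Rightarrow> nat \<Rightarrow> real) \<Rightarrow> real mat" where
  "mat1 nr nc f = mat nr nc (\<lambda>(i, j). f (i + 1) (j + 1))"

definition theta :: "nat \<Rightarrow> nat \<Rightarrow> real" where
  "theta N j = 2 * pi * (real j - 1) / real N"

definition trig :: "nat \<Rightarrow> real \<Rightarrow> real" where
  "trig c t =
     (if c = 1 then 1
      else if even c then cos (real (c div 2) * t)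
      else sin (real (c div 2) * t))"

definition S_mat :: "nat \<Rightarrow> nat \<Rightarrow> real \<Rightarrow> real \<Rightarrow> real mat" where
  "S_mat N M \<rho> R0 = mat1 N (2 * M + 1) (\<lambda>j c.
     if c = 1 then 1 else (R0 / \<rho>) ^ (c div 2) * trig c (theta N j))"

definition K_mat :: "nat \<Rightarrow> nat \<Rightarrow> real \<Rightarrow> real \<Rightarrow> real mat" where
  "K_mat N M R R0 = mat1 (2 * M + 1) N (\<lambda>c j.
     if c = 1 then 1
     else - (1 / real (c div 2)) * (R / R0) ^ (c div 2) * trig c (theta N j))"

definition T_mat :: "nat \<Rightarrow> nat \<Rightarrow> real mat" where
  "T_mat N M = mat1 (2 * M + 1) N (\<lambda>c j. trig c (theta N j))"

definition Lambda_mat :: "nat \<Rightarrow> real \<Rightarrow> real \<Rightarrow> real mat" where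
  "Lambda_mat M \<rho> R = mat1 (2 * M + 1) (2 * M + 1) (\<lambda>c d.
     if c \<noteq> d then 0
     else if c = 1 then 1
     else - (1 / real (c div 2)) * (R / \<rho>) ^ (c div 2))"

definition mmfs_coeffs ::
  "nat \<Rightarrow> nat \<Rightarrow> real \<Rightarrow> real \<Rightarrow> real \<Rightarrow> real vec \<Rightarrow> real vec \<Rightarrow> bool" where
  "mmfs_coeffs N M \<rho> R R0 f w \<longleftrightarrow>
     w \<in> carrier_vec N \<and> (S_mat N M \<rho> R0 * K_mat N M R R0) *\<^sub>v w = f"

definition source_point :: "nat \<Rightarrow> real \<Rightarrow> nat \<Rightarrow> complex" where
  "source_point N R j = of_real R * cis (theta N j)"

definition mmfs_potential :: "nat \<Rightarrow> real \<Rightarrow> real vec \<Rightarrow> complex \<Rightarrow> real" where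
  "mmfs_potential N R w z =
     (\<Sum>j = 1..N. w $ (j - 1) * ln (cmod (z - source_point N R j) / cmod z))"

text \<open>
  The potential is only meaningful for \<open>z \<noteq> 0\<close> away from the source points, so functions are
  compared on the closed exterior \<open>\<rho> \<le> cmod z\<close> of the disc.
\<close>

definition mmfs_approximation ::
  "nat \<Rightarrow> nat \<Rightarrow> real \<Rightarrow> real \<Rightarrow> real \<Rightarrow> real vec \<Rightarrow> (complex \<Rightarrow> real) \<Rightarrow> bool" where
  "mmfs_approximation N M \<rho> R R0 f u \<longleftrightarrow>
     (\<exists>w. mmfs_coeffs N M \<rho> R R0 f w \<and>
          (\<forall>z. \<rho> \<le> cmod z \<longrightarrow> u z = mmfs_potential N R w z))"

lemma S_mat_entries:
  assumes "j \<in> {1..N}" "k \<in> {1..M}"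
  shows "S_mat N M \<rho> R0 $$ (j - 1, 1 - 1) = 1"
    and "S_mat N M \<rho> R0 $$ (j - 1, 2 * k - 1) = (R0 / \<rho>) ^ k * cos (real k * theta N j)"
    and "S_mat N M \<rho> R0 $$ (j - 1, 2 * k + 1 - 1) = (R0 / \<rho>) ^ k * sin (real k * theta N j)"
  using assms by (auto simp: S_mat_def mat1_def trig_def)

lemma K_mat_entries:
  assumes "j \<in> {1..N}" "k \<in> {1..M}"
  shows "K_mat N M R R0 $$ (1 - 1, j - 1) = 1"
    and "K_mat N M R R0 $$ (2 * k - 1, j - 1) =
           - (1 / real k) * (R / R0) ^ k * cos (real k * theta N j)"
    and "K_mat N M R R0 $$ (2 * k + 1 - 1, j - 1) =
           - (1 / real k) * (R / R0) ^ k * sin (real k * theta N j)"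
  using assms by (auto simp: K_mat_def mat1_def trig_def)

lemma T_mat_entries:
  assumes "j \<in> {1..N}" "k \<in> {1..M}"
  shows "T_mat N M $$ (1 - 1, j - 1) = 1"
    and "T_mat N M $$ (2 * k - 1, j - 1) = cos (real k * theta N j)"
    and "T_mat N M $$ (2 * k + 1 - 1, j - 1) = sin (real k * theta N j)"
  using assms by (auto simp: T_mat_def mat1_def trig_def)

lemma Lambda_mat_entries:
  assumes "k \<in> {1..M}"
  shows "Lambda_mat M \<rho> R $$ (1 - 1, 1 - 1) = 1"
    and "Lambda_mat M \<rho> R $$ (2 * k - 1, 2 * k - 1) = - (1 / real k) * (R / \<rho>) ^ k"
    and "Lambda_mat M \<rho> R $$ (2 * k + 1 - 1, 2 * k + 1 - 1) = - (1 / real k) * (R / \<rho>) ^ k"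
    and "\<lbrakk>c \<in> {1..2 * M + 1}; d \<in> {1..2 * M + 1}; c \<noteq> d\<rbrakk>
           \<Longrightarrow> Lambda_mat M \<rho> R $$ (c - 1, d - 1) = 0"
  using assms by (auto simp: Lambda_mat_def mat1_def)

end

theory Submission
  imports Defs "Jordan_Normal_Form.Determinant"
begin

text \<open>
  The powers of \<open>R0\<close> cancel in the product \<open>S K\<close>, which gives the factorisation. Discrete
  orthogonality of the trigonometric system on \<open>N = 2 * M + 1\<close> equidistant nodes makes
  \<open>T T\<^sup>T\<close> diagonal with nonzero diagonal entries, so that \<open>T\<close>, \<open>\<Lambda>\<close> and hence \<open>S K\<close> have
  nonzero determinant.
\<close>

section \<open>Discrete orthogonality of the trigonometric system\<close>

text \<open>A geometric sum whose ratio is an \<open>N\<close>-th root of unity: it vanishes unless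
  the ratio is 1. The frequency \<open>m\<close> is an integer so that differences of frequencies
  are covered.\<close>

lemma sum_cis_theta:
  fixes m :: int
  assumes "N > 0"
  shows "(\<Sum>j = 1..N. cis (of_int m * theta N j)) = (if int N dvd m then of_nat N else 0)"
proof -
  define z where "z = cis (2 * pi * of_int m / real N)"
  \<comment> \<open>Node \<open>Suc j\<close> has angle \<open>2 * pi * j / N\<close>, so the
    exponents start at 0.\<close>
  have "cis (of_int m * theta N (Suc j)) = z ^ j" for j
    by (simp add: z_def DeMoivre theta_def field_simps)
  then have eq: "(\<Sum>j = 1..N. cis (of_int m * theta N j)) = (\<Sum>j<N. z ^ j)"
    by (simp add: sum.shift_bounds_Suc_ivl sum.atLeast1_atMost_eq)
  have "z ^ N = cis (2 * pi * of_int m)"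
    using assms by (simp add: z_def DeMoivre)
  then have zN: "z ^ N = 1"
    by (simp add: cis_multiple_2pi)
  have z1: "z = 1 \<longleftrightarrow> int N dvd m"
  proof
    assume "z = 1"
    then have "cos (2 * pi * of_int m / real N) = 1"
      by (simp add: z_def complex_eq_iff)
    then obtain n :: int where "2 * pi * of_int m / real N = of_int n * 2 * pi"
      by (auto simp: cos_one_2pi_int)
    then have "real_of_int m = real_of_int (n * int N)"
      using assms by (simp add: field_simps)
    then show "int N dvd m"
      by (simp only: of_int_eq_iff dvd_triv_right)
  next
    assume "int N dvd m"
    then obtain n where "m = int N * n" ..
    then have "2 * pi * real_of_int m / real N = 2 * pi * of_int n"
      using assms by simp
    then show "z = 1"
      unfolding z_def by (simp only: cis_multiple_2pi[OF Ints_of_int])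
  qed
  show ?thesis
  proof (cases "z = 1")
    case True
    then show ?thesis using z1 unfolding eq by simp
  next
    case False
    then show ?thesis using z1 zN unfolding eq by (simp add: geometric_sum)
  qed
qed

lemma sum_cos_theta:
  fixes m :: int
  assumes "N > 0"
  shows "(\<Sum>j = 1..N. cos (of_int m * theta N j)) = (if int N dvd m then real N else 0)"
  using arg_cong[OF sum_cis_theta[OF assms, of m], of Re] by simp

lemma sum_sin_theta:
  fixes m :: int
  assumes "N > 0"
  shows "(\<Sum>j = 1..N. sin (of_int m * theta N j)) = 0"
  using arg_cong[OF sum_cis_theta[OF assms, of m], of Im] by simp

text \<open>By the product-to-sum formula only the frequencies \<open>k - l\<close> and
  \<open>k + l\<close> occur. Both are smaller than \<open>N\<close> in absolute value, so
  \<open>N\<close> divides one of them only if it is 0. For \<open>k = l > 0\<close> the difference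
  alone contributes; for \<open>k = l = 0\<close> both do.\<close>

lemma sum_cos_cos_theta:
  fixes k l :: nat
  assumes "k + l < N"
  shows "(\<Sum>j = 1..N. cos (real k * theta N j) * cos (real l * theta N j)) =
    (if k \<noteq> l then 0 else if k = 0 then real N else real N / 2)"
proof -
  have "(\<Sum>j = 1..N. cos (real k * theta N j) * cos (real l * theta N j)) =
    ((\<Sum>j = 1..N. cos (of_int (int k - int l) * theta N j)) +
     (\<Sum>j = 1..N. cos (of_int (int k + int l) * theta N j))) / 2"
    by (simp add: cos_times_cos sum.distrib[symmetric] sum_divide_distrib algebra_simps)
  moreover have "int N dvd int k - int l \<longleftrightarrow> k = l"
    using assms dvd_imp_le_int[of "int k - int l" "int N"] by (cases "k = l") auto
  moreover have "int N dvd int k + int l \<longleftrightarrow> k = 0 \<and> l = 0"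
    using assms by (auto dest: zdvd_imp_le)
  ultimately show ?thesis
    using assms by (simp only: sum_cos_theta) auto
qed

text \<open>The addition formula for \<open>cos (x - y)\<close> reduces this to the cosine products.
  The condition \<open>k > 0\<close> excludes \<open>k = l = 0\<close>, where the sum is 0.\<close>

lemma sum_sin_sin_theta:
  fixes k l :: nat
  assumes "k + l < N" "k > 0"
  shows "(\<Sum>j = 1..N. sin (real k * theta N j) * sin (real l * theta N j)) =
    (if k \<noteq> l then 0 else real N / 2)"
proof -
  have "(\<Sum>j = 1..N. sin (real k * theta N j) * sin (real l * theta N j)) =
    (\<Sum>j = 1..N. cos (of_int (int k - int l) * theta N j)) -
    (\<Sum>j = 1..N. cos (real k * theta N j) * cos (real l * theta N j))"
    by (simp add: cos_diff sum_subtractf[symmetric] algebra_simps)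
  moreover have "int N dvd int k - int l \<longleftrightarrow> k = l"
    using assms dvd_imp_le_int[of "int k - int l" "int N"] by (cases "k = l") auto
  ultimately show ?thesis
    using assms by (simp only: sum_cos_theta sum_cos_cos_theta) auto
qed

lemma sum_sin_cos_theta:
  fixes k l :: nat
  assumes "N > 0"
  shows "(\<Sum>j = 1..N. sin (real k * theta N j) * cos (real l * theta N j)) = 0"
proof -
  have "(\<Sum>j = 1..N. sin (real k * theta N j) * cos (real l * theta N j)) =
    ((\<Sum>j = 1..N. sin (of_int (int k + int l) * theta N j)) +
     (\<Sum>j = 1..N. sin (of_int (int k - int l) * theta N j))) / 2"
    by (simp add: sin_times_cos sum.distrib[symmetric] sum_divide_distrib distrib_right
        left_diff_distrib)
  then show ?thesis
    using assms by (simp only: sum_sin_theta) simp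
qed

text \<open>The constant function joins the cosines as frequency \<open>1 div 2 = 0\<close>, so
  products of basis functions are only of cosine and sine types.\<close>

lemma trig_cases:
  assumes "c > 0"
  obtains (cos) "trig c = (\<lambda>t. cos (real (c div 2) * t))" "even c \<or> c = 1"
  | (sin) "trig c = (\<lambda>t. sin (real (c div 2) * t))" "odd c" "c div 2 > 0"
proof (cases "even c \<or> c = 1")
  case True
  then show ?thesis
    by (intro cos) (auto simp: trig_def)
next
  case False
  moreover from this have "c div 2 > 0"
    using assms by presburger
  ultimately show ?thesis
    by (intro sin) (auto simp: trig_def)
qed

text \<open>These are the entries of \<open>T T\<^sup>T\<close>. Each frequency is at most
  \<open>M\<close>, so two of them add up to at most \<open>2 * M < N\<close>, as the product sums
  require.\<close>

lemma trig_orthogonal: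
  assumes "c \<in> {1..2 * M + 1}" "d \<in> {1..2 * M + 1}" and N: "N = 2 * M + 1"
  shows "(\<Sum>j = 1..N. trig c (theta N j) * trig d (theta N j)) =
    (if c \<noteq> d then 0 else if c = 1 then real N else real N / 2)"
proof -
  have pos: "c > 0" "d > 0" "N > 0" and le: "c div 2 + d div 2 < N"
    using assms by auto presburger
  from pos(1) show ?thesis
  proof (cases rule: trig_cases)
    case c: cos
    from pos(2) show ?thesis
    proof (cases rule: trig_cases)
      case d: cos
      \<comment> \<open>Within the cosine family the frequency determines the index:
        \<open>c\<close> is even and positive, or it is 1.\<close>
      have "c div 2 = d div 2 \<longleftrightarrow> c = d" "c div 2 = 0 \<longleftrightarrow> c = 1"
        using c(2) d(2) pos by (auto elim!: evenE)
      then show ?thesis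
        by (simp only: c(1) d(1) sum_cos_cos_theta[OF le])
    next
      case d: sin
      then show ?thesis
        using c sum_sin_cos_theta[OF pos(3), of "d div 2" "c div 2"] by (auto simp: mult.commute)
    qed
  next
    case c: sin
    from pos(2) show ?thesis
    proof (cases rule: trig_cases)
      case d: cos
      then show ?thesis
        using c sum_sin_cos_theta[OF pos(3), of "c div 2" "d div 2"] by auto
    next
      case d: sin
      have "c div 2 = d div 2 \<longleftrightarrow> c = d" "c \<noteq> 1"
        using c d by (auto elim!: oddE)
      then show ?thesis
        by (simp only: c(1) d(1) sum_sin_sin_theta[OF le c(3)]) auto
    qed
  qed
qed

section \<open>Determinants and unique solvability\<close>

lemma det_diagonal_nonzero:
  fixes A :: "'a :: idom mat"
  assumes A: "A \<in> carrier_mat n n" and "diagonal_mat A"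
    and nz: "\<And>i. i < n \<Longrightarrow> A $$ (i, i) \<noteq> 0"
  shows "det A \<noteq> 0"
proof -
  have "upper_triangular A"
    using assms by (auto simp: diagonal_mat_def)
  then have "det A = prod_list (diag_mat A)"
    using A by (rule det_upper_triangular)
  then show ?thesis
    using A nz by (auto simp: prod_list_zero_iff diag_mat_def)
qed

text \<open>A nonzero determinant makes \<open>A\<close> a unit of the matrix ring. Its right
  inverse property gives the solution \<open>B *\<^sub>v f\<close>, its left inverse property the
  uniqueness.\<close>

lemma unique_solution_if_det_nonzero:
  fixes A :: "'a :: field mat"
  assumes A: "A \<in> carrier_mat n n" and "det A \<noteq> 0" and f: "f \<in> carrier_vec n"
  shows "\<exists>!w. w \<in> carrier_vec n \<and> A *\<^sub>v w = f"
proof -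
  have "A \<in> Units (ring_mat TYPE('a) n ())"
    using assms by (intro det_non_zero_imp_unit)
  then obtain B where B: "B \<in> carrier_mat n n" "B * A = 1\<^sub>m n" "A * B = 1\<^sub>m n"
    by (auto simp: Units_def ring_mat_def)
  show ?thesis
  proof (rule ex1I)
    show "B *\<^sub>v f \<in> carrier_vec n \<and> A *\<^sub>v (B *\<^sub>v f) = f"
      using A B f by (simp add: assoc_mult_mat_vec[symmetric])
  next
    fix w
    assume w: "w \<in> carrier_vec n \<and> A *\<^sub>v w = f"
    then have "(B * A) *\<^sub>v w = B *\<^sub>v f"
      using A B by (metis assoc_mult_mat_vec)
    then show "w = B *\<^sub>v f"
      using B w by simp
  qed
qed

section \<open>Factorisation of \<open>S K\<close> and determinants of its factors\<close>

lemma T_mat_carrier: "T_mat N M \<in> carrier_mat (2 * M + 1) N"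
  by (simp add: T_mat_def mat1_def)

lemma Lambda_mat_carrier: "Lambda_mat M \<rho> R \<in> carrier_mat (2 * M + 1) (2 * M + 1)"
  by (simp add: Lambda_mat_def mat1_def)

lemma S_mult_K_eq:
  assumes "R0 \<noteq> 0"
  shows "S_mat N M \<rho> R0 * K_mat N M R R0 =
    transpose_mat (T_mat N M) * Lambda_mat M \<rho> R * T_mat N M" (is "?L = ?R")
proof (rule eq_matI)
  fix i j
  assume "i < dim_row ?R" "j < dim_col ?R"
  then have ij: "i < N" "j < N"
    by (simp_all add: T_mat_def mat1_def)
  let ?n = "2 * M + 1"
  let ?t = "\<lambda>c j. trig (c + 1) (theta N (j + 1))"
  \<comment> \<open>Here \<open>c\<close> counts from 0, so \<open>?l c\<close> is the diagonal
    entry of \<open>\<Lambda>\<close> with index \<open>c + 1\<close>; both sides will be reduced to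
    the same sum over \<open>c\<close>.\<close>
  let ?l = "\<lambda>c. if c = 0 then 1 else - (1 / real ((c + 1) div 2)) * (R / \<rho>) ^ ((c + 1) div 2)"
  have summand: "S_mat N M \<rho> R0 $$ (i, c) * K_mat N M R R0 $$ (c, j) = ?t c i * ?l c * ?t c j"
    if "c < ?n" for c
  proof (cases "c = 0")
    case True
    then show ?thesis
      using ij by (simp add: S_mat_def K_mat_def mat1_def trig_def)
  next
    case False
    \<comment> \<open>The cancellation of \<open>R0\<close>, and the point where
      \<open>R0 \<noteq> 0\<close> enters.\<close>
    have "(R / \<rho>) ^ k = (R0 / \<rho>) ^ k * (R / R0) ^ k" for k
      using assms by (simp add: power_mult_distrib[symmetric])
    then show ?thesis
      using False ij that by (simp add: S_mat_def K_mat_def mat1_def)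
  qed
  have "?L $$ (i, j) = (\<Sum>c<?n. S_mat N M \<rho> R0 $$ (i, c) * K_mat N M R R0 $$ (c, j))"
    using ij by (simp add: S_mat_def K_mat_def mat1_def scalar_prod_def atLeast0LessThan)
  also have "\<dots> = (\<Sum>c<?n. ?t c i * ?l c * ?t c j)"
    by (rule sum.cong[OF refl]) (simp only: summand lessThan_iff)
  finally have L: "?L $$ (i, j) = (\<Sum>c<?n. ?t c i * ?l c * ?t c j)" .
  have T: "T_mat N M $$ (c, j) = ?t c j" if "c < ?n" for c
    using ij that by (simp add: T_mat_def mat1_def)
  have TL: "(transpose_mat (T_mat N M) * Lambda_mat M \<rho> R) $$ (i, c) = ?t c i * ?l c"
    if "c < ?n" for c
  proof -
    have "(transpose_mat (T_mat N M) * Lambda_mat M \<rho> R) $$ (i, c) =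
      (\<Sum>d<?n. T_mat N M $$ (d, i) * Lambda_mat M \<rho> R $$ (d, c))"
      using ij that
      by (simp add: T_mat_def Lambda_mat_def mat1_def scalar_prod_def atLeast0LessThan)
    also have "\<dots> = (\<Sum>d<?n. if d = c then ?t c i * ?l c else 0)"
      using ij that
      by (intro sum.cong refl) (auto simp: T_mat_def Lambda_mat_def mat1_def)
    finally show ?thesis
      using that by (simp only: sum.delta finite_lessThan lessThan_iff if_True)
  qed
  \<comment> \<open>The triple product stays bracketed to the left, so that \<open>TL\<close>
    supplies the entries of its first factor.\<close>
  have "?R $$ (i, j) =
    (\<Sum>c<?n. (transpose_mat (T_mat N M) * Lambda_mat M \<rho> R) $$ (i, c) * T_mat N M $$ (c, j))"
    using ij T_mat_carrier[of N M] Lambda_mat_carrier[of M \<rho> R]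
    by (simp add: scalar_prod_def atLeast0LessThan del: assoc_mult_mat)
  also have "\<dots> = (\<Sum>c<?n. ?t c i * ?l c * ?t c j)"
    by (rule sum.cong[OF refl]) (simp only: TL T lessThan_iff)
  finally show "?L $$ (i, j) = ?R $$ (i, j)"
    by (simp add: L)
qed (simp_all add: S_mat_def K_mat_def T_mat_def mat1_def)

text \<open>\<open>T T\<^sup>T\<close> is the Gram matrix of the sampled basis functions. Its
  determinant is a multiple of \<open>det T\<close>, so it suffices that the Gram determinant is
  nonzero.\<close>

lemma det_T_mat_nonzero:
  assumes N: "N = 2 * M + 1"
  shows "det (T_mat N M) \<noteq> 0"
proof -
  let ?T = "T_mat N M"
  have T: "?T \<in> carrier_mat N N"
    using T_mat_carrier N by metis
  have entry: "(?T * transpose_mat ?T) $$ (i, j) =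
    (if i \<noteq> j then 0 else if i = 0 then real N else real N / 2)" if "i < N" "j < N" for i j
  proof -
    have "(?T * transpose_mat ?T) $$ (i, j) =
      (\<Sum>l<N. trig (i + 1) (theta N (l + 1)) * trig (j + 1) (theta N (l + 1)))"
      using that N by (simp add: T_mat_def mat1_def scalar_prod_def atLeast0LessThan)
    also have "\<dots> = (\<Sum>l = 1..N. trig (i + 1) (theta N l) * trig (j + 1) (theta N l))"
      by (simp add: sum.atLeast1_atMost_eq)
    also have "\<dots> = (if i \<noteq> j then 0 else if i = 0 then real N else real N / 2)"
      using that N by (subst trig_orthogonal[where M = M]) auto
    finally show ?thesis .
  qed
  have "det (?T * transpose_mat ?T) \<noteq> 0"
  proof (rule det_diagonal_nonzero)
    show "?T * transpose_mat ?T \<in> carrier_mat N N"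
      using T by simp
    show "diagonal_mat (?T * transpose_mat ?T)"
      unfolding diagonal_mat_def using T entry
      by (metis carrier_matD(1) index_mult_mat(2,3) index_transpose_mat(3))
    show "(?T * transpose_mat ?T) $$ (i, i) \<noteq> 0" if "i < N" for i
      using entry[OF that that] N by simp
  qed
  then show ?thesis
    using det_mult[OF T, of "transpose_mat ?T"] T by auto
qed

lemma det_Lambda_mat_nonzero:
  assumes "R \<noteq> 0" "\<rho> \<noteq> 0"
  shows "det (Lambda_mat M \<rho> R) \<noteq> 0"
proof (rule det_diagonal_nonzero[OF Lambda_mat_carrier])
  show "diagonal_mat (Lambda_mat M \<rho> R)"
    by (simp add: diagonal_mat_def Lambda_mat_def mat1_def)
  \<comment> \<open>For \<open>i > 0\<close> the frequency \<open>(i + 1) div 2\<close> is at least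
    1, so its reciprocal is not the default value 0 of division by zero.\<close>
  show "Lambda_mat M \<rho> R $$ (i, i) \<noteq> 0" if "i < 2 * M + 1" for i
    using that assms by (auto simp: Lambda_mat_def mat1_def)
qed

section \<open>Unique solvability of the system and uniqueness of the approximate solution\<close>

theorem theorem2:
  fixes M N :: nat and \<rho> R R0 :: real
  assumes "M \<ge> 1" and "N = 2 * M + 1"
    and "\<rho> > 0" and "0 < R" and "R < \<rho>" and "R0 > 0"
  shows "S_mat N M \<rho> R0 * K_mat N M R R0 =
           transpose_mat (T_mat N M) * Lambda_mat M \<rho> R * T_mat N M
       \<and> (\<forall>f \<in> carrier_vec N.
            \<exists>!w. w \<in> carrier_vec N \<and> (S_mat N M \<rho> R0 * K_mat N M R R0) *\<^sub>v w = f)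
       \<and> (\<forall>f \<in> carrier_vec N.
            (\<exists>u. mmfs_approximation N M \<rho> R R0 f u) \<and>
            (\<forall>u v. mmfs_approximation N M \<rho> R R0 f u \<longrightarrow>
                   mmfs_approximation N M \<rho> R R0 f v \<longrightarrow>
                   (\<forall>z. \<rho> \<le> cmod z \<longrightarrow> u z = v z)))"
proof -
  let ?A = "S_mat N M \<rho> R0 * K_mat N M R R0" and ?T = "T_mat N M" and ?L = "Lambda_mat M \<rho> R"
  have eq: "?A = transpose_mat ?T * ?L * ?T"
    using assms by (intro S_mult_K_eq) simp
  have T: "?T \<in> carrier_mat N N" and L: "?L \<in> carrier_mat N N"
    using T_mat_carrier Lambda_mat_carrier assms(2) by metis+
  \<comment> \<open>Since \<open>N = 2 * M + 1\<close>, all factors are square and the determinant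
    is multiplicative.\<close>
  then have "det ?A = det ?T * det ?L * det ?T"
    by (simp add: eq det_mult[of _ N] det_transpose)
  then have det: "det ?A \<noteq> 0"
    using assms by (simp add: det_T_mat_nonzero det_Lambda_mat_nonzero)
  have A: "?A \<in> carrier_mat N N"
    using T L by (simp add: eq)
  have uniq: "\<forall>f \<in> carrier_vec N. \<exists>!w. w \<in> carrier_vec N \<and> ?A *\<^sub>v w = f"
    using unique_solution_if_det_nonzero[OF A det] by (rule ballI)
  have "(\<exists>u. mmfs_approximation N M \<rho> R R0 f u) \<and>
      (\<forall>u v. mmfs_approximation N M \<rho> R R0 f u \<longrightarrow> mmfs_approximation N M \<rho> R R0 f v \<longrightarrow>
        (\<forall>z. \<rho> \<le> cmod z \<longrightarrow> u z = v z))" if "f \<in> carrier_vec N" for f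
  proof -
    have "\<exists>!w. mmfs_coeffs N M \<rho> R R0 f w"
      using bspec[OF uniq that] by (simp only: mmfs_coeffs_def)
    then obtain w where w: "mmfs_coeffs N M \<rho> R R0 f w"
      and w_unique: "\<And>w'. mmfs_coeffs N M \<rho> R R0 f w' \<Longrightarrow> w' = w"
      by blast
    \<comment> \<open>The potential of the unique coefficient vector is an approximate solution, and
      every other one agrees with it on the closed exterior.\<close>
    have "mmfs_approximation N M \<rho> R R0 f (mmfs_potential N R w)"
      using w by (auto simp: mmfs_approximation_def)
    moreover have "u z = mmfs_potential N R w z"
      if "mmfs_approximation N M \<rho> R R0 f u" "\<rho> \<le> cmod z" for u z
      using that w_unique by (auto simp: mmfs_approximation_def)
    ultimately show ?thesis
      by metis
  qed
  with eq uniq show ?thesis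
    by blast
qed

end
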